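(* Let $t\ge 1$ and let $l_1,\dots,l_t$ be positive integers with $l_1\ge 2$ and $l_t\ge 2$. Then the generalized zigzag graph $GZZ(l_1,\dots,l_t)$ is primitively log divergent.
   Context: Generalized zigzag graph $GZZ(l_1,\dots,l_t)$: start with vertices $u_1,\dots,u_{t+2}$ and edges $(u_i,u_{i+1})$ for $1\le i\le t+1$. For each $1\le i\le t$ add $l_i-1$ new vertices $v_{i1},\dots,v_{i,l_i-1}$, the $l_i$ edges of the path $u_i,v_{i1},\dots,v_{i,l_i-1},u_{i+2}$ (if $l_i=1$ this is the single edge $(u_i,u_{i+2})$), and the $l_i-1$ edges $(v_{ij},u_{i+1})$, $1\le j\le l_i-1$. Finally add the edge $(u_1,u_{t+2})$. For a finite graph $\Gamma$ let $h_1(\Gamma)=\mathrm{rank}\,H_1(\Gamma,\mathbb{Z})$. $\Gamma$ is convergent if $|E(\Gamma)|>2h_1(\Gamma)$, and logarithmically divergent if $|E(\Gamma)|=2h_1(\Gamma)$. A logarithmically divergent graph $\Gamma$ is primitively log divergent if every connected proper subgraph $\Gamma'\subset\Gamma$ (determined by its nonempty set of edges, a proper subset of the edges of $\Gamma$) is convergent. *)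

theory Defs
  imports
    "Graph_Theory.Digraph"
    "Graph_Theory.Digraph_Component"
    "HOL-Library.Poly_Mapping"
begin

text \<open>
  A finite undirected multigraph is represented by a \<^typ>\<open>('v, 'e) pre_digraph\<close> having exactly one
  arc per edge, i.e. by a choice of orientation.  The orientation only enters the signs of the
  boundary map below, and \<^const>\<open>Digraph_Component.connected\<close> means connectedness of the underlying
  undirected graph.
\<close>

definition boundary :: "('v, 'e) pre_digraph \<Rightarrow> ('e \<Rightarrow>\<^sub>0 int) \<Rightarrow> ('v \<Rightarrow>\<^sub>0 int)" where
  "boundary G = frag_extend (\<lambda>e. frag_of (head G e) - frag_of (tail G e))"

text \<open>A graph has no cells of dimension 2, so its first homology group is the group of 1-cycles.\<close>

definition H1 :: "('v, 'e) pre_digraph \<Rightarrow> ('e \<Rightarrow>\<^sub>0 int) set" where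
  "H1 G = {c. Poly_Mapping.keys c \<subseteq> arcs G \<and> boundary G c = 0}"

lemma module_frag_cmul: "module (frag_cmul :: int \<Rightarrow> ('a \<Rightarrow>\<^sub>0 int) \<Rightarrow> _)"
  by unfold_locales (simp_all add: frag_cmul_distrib frag_cmul_distrib2)

text \<open>
  Rank of an abelian group: the maximal number of elements linearly independent over the integers.
  The supremum is meaningful for groups of finite rank only.
\<close>

definition Z_rank :: "('a \<Rightarrow>\<^sub>0 int) set \<Rightarrow> nat" where
  "Z_rank A = Sup {card B |B. finite B \<and> B \<subseteq> A \<and> \<not> module.dependent frag_cmul B}"

definition h1 :: "('v, 'e) pre_digraph \<Rightarrow> nat" where
  "h1 G = Z_rank (H1 G)"

definition convergent_graph :: "('v, 'e) pre_digraph \<Rightarrow> bool" where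
  "convergent_graph G \<longleftrightarrow> card (arcs G) > 2 * h1 G"

definition log_divergent :: "('v, 'e) pre_digraph \<Rightarrow> bool" where
  "log_divergent G \<longleftrightarrow> card (arcs G) = 2 * h1 G"

definition edge_subgraph :: "('v, 'e) pre_digraph \<Rightarrow> 'e set \<Rightarrow> ('v, 'e) pre_digraph" where
  "edge_subgraph G A = \<lparr>verts = tail G ` A \<union> head G ` A, arcs = A, tail = tail G, head = head G\<rparr>"

definition primitively_log_divergent :: "('v, 'e) pre_digraph \<Rightarrow> bool" where
  "primitively_log_divergent G \<longleftrightarrow>
     log_divergent G \<and>
     (\<forall>A. A \<noteq> {} \<and> A \<subset> arcs G \<and> Digraph_Component.connected (edge_subgraph G A)
        \<longrightarrow> convergent_graph (edge_subgraph G A))"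

datatype gzz_vertex = U nat | V nat nat

text \<open>
  \<open>Spine i\<close> is the edge \<open>(u\<^sub>i, u\<^sub>i\<^sub>+\<^sub>1)\<close>, \<open>Side i j\<close> the edge number \<open>j\<close> (from 0) of the path
  from \<open>u\<^sub>i\<close> to \<open>u\<^sub>i\<^sub>+\<^sub>2\<close>, \<open>Spoke i j\<close> the edge \<open>(v\<^sub>i\<^sub>j, u\<^sub>i\<^sub>+\<^sub>1)\<close>, and \<open>Closing\<close> the edge
  \<open>(u\<^sub>1, u\<^sub>t\<^sub>+\<^sub>2)\<close>.
\<close>

datatype gzz_edge = Spine nat | Side nat nat | Spoke nat nat | Closing

definition side_vertex :: "(nat \<Rightarrow> nat) \<Rightarrow> nat \<Rightarrow> nat \<Rightarrow> gzz_vertex" where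
  "side_vertex l i j = (if j = 0 then U i else if j = l i then U (i + 2) else V i j)"

fun gzz_tail :: "(nat \<Rightarrow> nat) \<Rightarrow> gzz_edge \<Rightarrow> gzz_vertex" where
  "gzz_tail l (Spine i) = U i"
| "gzz_tail l (Side i j) = side_vertex l i j"
| "gzz_tail l (Spoke i j) = V i j"
| "gzz_tail l Closing = U 1"

fun gzz_head :: "nat \<Rightarrow> (nat \<Rightarrow> nat) \<Rightarrow> gzz_edge \<Rightarrow> gzz_vertex" where
  "gzz_head t l (Spine i) = U (i + 1)"
| "gzz_head t l (Side i j) = side_vertex l i (j + 1)"
| "gzz_head t l (Spoke i j) = U (i + 1)"
| "gzz_head t l Closing = U (t + 2)"

definition GZZ :: "nat \<Rightarrow> (nat \<Rightarrow> nat) \<Rightarrow> (gzz_vertex, gzz_edge) pre_digraph" where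
  "GZZ t l = \<lparr>
     verts = U ` {1..t + 2} \<union> {V i j |i j. i \<in> {1..t} \<and> j \<in> {1..<l i}},
     arcs = Spine ` {1..t + 1}
          \<union> {Side i j |i j. i \<in> {1..t} \<and> j \<in> {0..<l i}}
          \<union> {Spoke i j |i j. i \<in> {1..t} \<and> j \<in> {1..<l i}}
          \<union> {Closing},
     tail = gzz_tail l,
     head = gzz_head t l\<rparr>"

lemma fin_digraph_GZZ: "fin_digraph (GZZ t l)"
proof
  have "{V i j |i j. i \<in> {1..t} \<and> j \<in> {1..<l i}} = (\<Union>i\<in>{1..t}. V i ` {1..<l i})"
    by auto
  then show "finite (verts (GZZ t l))"
    by (simp add: GZZ_def)
  have "{Side i j |i j. i \<in> {1..t} \<and> j \<in> {0..<l i}} = (\<Union>i\<in>{1..t}. Side i ` {0..<l i})"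
       "{Spoke i j |i j. i \<in> {1..t} \<and> j \<in> {1..<l i}} = (\<Union>i\<in>{1..t}. Spoke i ` {1..<l i})"
    by auto
  then show "finite (arcs (GZZ t l))"
    by (simp add: GZZ_def)
qed (auto simp: GZZ_def side_vertex_def)

end

theory Submission
  imports Defs "HOL-Library.Product_Lexorder"
begin

text \<open>
  A connected graph with \<open>n\<close> vertices and \<open>m\<close> edges has \<open>h\<^sub>1 = m - n + 1\<close>: its cycles are cut out of the
  free group on the edges by the vanishing of the boundary at all vertices but one, and each of
  these conditions lowers the rank by one.  So the graph is logarithmically divergent iff
  \<open>m = 2n - 2\<close> and convergent iff \<open>m \<le> 2n - 3\<close>.

  Without the closing edge, the zigzag graph is built by joining each new vertex after the second to
  two earlier ones, which gives \<open>m = 2n - 3\<close> for the whole and \<open>m \<le> 2n - 3\<close> for every subgraph.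
  Let a proper subgraph contain the closing edge.  If it misses \<open>u\<^sub>2\<close>, then \<open>u\<^sub>1\<close> has degree at most 2
  in it and can be removed.  If it contains \<open>u\<^sub>2\<close>, then it lacks an edge joining one of its vertices
  to an earlier vertex: each vertex other than \<open>u\<^sub>t\<^sub>+\<^sub>2\<close> is joined to a later one, so otherwise it would
  be the whole graph.  This missing edge compensates for the closing one.
\<close>

section \<open>Ranks of modules over integral domains\<close>

locale idom_module = module scale
  for scale :: "'r::idom \<Rightarrow> 'm::ab_group_add \<Rightarrow> 'm" (infixr \<open>*s\<close> 75)
begin

definition has_rank :: "'m set \<Rightarrow> nat \<Rightarrow> bool" where
  "has_rank M n \<longleftrightarrow>
     (\<exists>B\<subseteq>M. finite B \<and> independent B \<and> card B = n) \<and>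
     (\<forall>B\<subseteq>M. finite B \<and> independent B \<longrightarrow> card B \<le> n)"

lemma has_rank_unique:
  assumes "has_rank M m" "has_rank M n"
  shows "m = n"
  using assms unfolding has_rank_def by (metis le_antisym)

lemma has_rank_zero: "has_rank {0} 0"
proof -
  have "B = {}" if "B \<subseteq> {0}" "independent B" for B
    using that dependent_zero[of B] by blast
  then show ?thesis
    unfolding has_rank_def using independent_empty by fastforce
qed

lemma has_rank_subset:
  assumes "has_rank M m" "N \<subseteq> M"
  obtains n where "has_rank N n"
proof -
  define cards where "cards = card ` {B. B \<subseteq> N \<and> finite B \<and> independent B}"
  have "cards \<subseteq> {..m}"
    using assms by (fastforce simp: cards_def has_rank_def)
  then have fin: "finite cards"
    by (rule finite_subset) simp
  have "card ({} :: 'm set) \<in> cards"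
    unfolding cards_def by (rule imageI) (simp add: independent_empty)
  then have "Max cards \<in> cards"
    using fin by (intro Max_in) auto
  then have "has_rank N (Max cards)"
    using Max_ge[OF fin] by (auto simp: has_rank_def cards_def)
  then show thesis ..
qed

lemma independent_family:
  assumes "finite I"
    and indep: "\<And>u i. (\<Sum>i\<in>I. u i *s g i) = 0 \<Longrightarrow> i \<in> I \<Longrightarrow> u i = 0"
  shows "inj_on g I" and "independent (g ` I)"
proof -
  show inj: "inj_on g I"
  proof (rule inj_onI, rule ccontr)
    fix i j assume ij: "i \<in> I" "j \<in> I" "g i = g j" "i \<noteq> j"
    define u :: "_ \<Rightarrow> 'r" where "u k = (if k = i then 1 else if k = j then - 1 else 0)" for k
    have "(\<Sum>k\<in>I. u k *s g k) = (\<Sum>k\<in>{i, j}. u k *s g k)"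
      using ij \<open>finite I\<close> by (intro sum.mono_neutral_right) (auto simp: u_def)
    also have "\<dots> = 0"
      using ij by (simp add: u_def)
    finally have "u i = 0"
      using indep ij by blast
    then show False
      by (simp add: u_def)
  qed
  show "independent (g ` I)"
  proof
    assume "dependent (g ` I)"
    then obtain u i where "i \<in> I" "u (g i) \<noteq> 0" and "(\<Sum>v\<in>g ` I. u v *s v) = 0"
      using \<open>finite I\<close> by (auto simp: dependent_finite)
    moreover from this have "(\<Sum>i\<in>I. u (g i) *s g i) = 0"
      using inj by (simp add: sum.reindex)
    ultimately show False
      using indep[of "u \<circ> g"] by simp
  qed
qed

lemma independent_eliminate:
  fixes k :: 'r
  assumes B: "finite B" "independent B" "pivot \<in> B" and "k \<noteq> 0"
  shows "inj_on (\<lambda>b. k *s b - r b *s pivot) (B - {pivot})"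
    and "independent ((\<lambda>b. k *s b - r b *s pivot) ` (B - {pivot}))"
proof -
  have zero: "u b = 0"
    if sum: "(\<Sum>b\<in>B - {pivot}. u b *s (k *s b - r b *s pivot)) = 0" and b: "b \<in> B - {pivot}"
    for u b
  proof -
    define w where "w b = (if b = pivot then - (\<Sum>b\<in>B - {pivot}. u b * r b) else u b * k)" for b
    have "(\<Sum>b\<in>B. w b *s b) = w pivot *s pivot + (\<Sum>b\<in>B - {pivot}. (u b * k) *s b)"
      using B by (simp add: sum.remove w_def)
    also have "\<dots> = (\<Sum>b\<in>B - {pivot}. u b *s (k *s b - r b *s pivot))"
      by (simp add: w_def scale_right_diff_distrib scale_sum_left sum_subtractf)
    finally have "w b = 0"
      using sum b B by (intro independentD[OF \<open>independent B\<close> _ order_refl]) auto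
    then show ?thesis
      using b \<open>k \<noteq> 0\<close> by (simp add: w_def)
  qed
  show "inj_on (\<lambda>b. k *s b - r b *s pivot) (B - {pivot})"
    using zero B by (intro independent_family) auto
  show "independent ((\<lambda>b. k *s b - r b *s pivot) ` (B - {pivot}))"
    using zero B by (intro independent_family) auto
qed

lemma independent_insert_kernel:
  assumes "module_hom scale (*) \<phi>"
    and B: "finite B" "independent B" "\<And>b. b \<in> B \<Longrightarrow> \<phi> b = 0" and a: "\<phi> a \<noteq> 0"
  shows "independent (insert a B)"
proof
  interpret \<phi>: module_hom scale "(*)" \<phi> by fact
  have "a \<notin> B"
    using B a by blast
  assume "dependent (insert a B)"
  then obtain u v where u: "v \<in> insert a B" "u v \<noteq> 0" and sum: "(\<Sum>b\<in>insert a B. u b *s b) = 0"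
    using B by (auto simp: dependent_finite)
  have "\<phi> (\<Sum>b\<in>insert a B. u b *s b) = u a * \<phi> a"
    using B \<open>a \<notin> B\<close> by (simp add: \<phi>.add \<phi>.sum \<phi>.scale)
  then have "u a = 0"
    using sum a by simp
  then have "(\<Sum>b\<in>B. u b *s b) = 0"
    using sum B \<open>a \<notin> B\<close> by simp
  then have "u b = 0" if "b \<in> B" for b
    using that independentD[OF \<open>independent B\<close>] B by blast
  then show False
    using u \<open>u a = 0\<close> by blast
qed

lemma card_independent_le_Suc_rank_kernel:
  assumes M: "subspace M" and "module_hom scale (*) \<phi>"
    and ker: "has_rank {x \<in> M. \<phi> x = 0} n"
    and B: "B \<subseteq> M" "finite B" "independent B"
  shows "card B \<le> Suc n"
proof -
  interpret \<phi>: module_hom scale "(*)" \<phi> by fact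
  have ker_bound: "card C \<le> n" if "C \<subseteq> {x \<in> M. \<phi> x = 0}" "finite C" "independent C" for C
    using ker that unfolding has_rank_def by blast
  show ?thesis
  proof (cases "\<forall>b\<in>B. \<phi> b = 0")
    case True
    then have "card B \<le> n"
      using B by (intro ker_bound) auto
    then show ?thesis
      by simp
  next
    case False
    then obtain pivot where pivot: "pivot \<in> B" "\<phi> pivot \<noteq> 0"
      by blast
    define g where "g b = \<phi> pivot *s b - \<phi> b *s pivot" for b
    have "g ` (B - {pivot}) \<subseteq> {x \<in> M. \<phi> x = 0}"
      using B pivot
      by (auto simp: g_def \<phi>.diff \<phi>.scale intro!: subspace_diff[OF M] subspace_scale[OF M])
    moreover have "inj_on g (B - {pivot})" "independent (g ` (B - {pivot}))"
      unfolding g_def using B pivot by (simp_all add: independent_eliminate)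
    ultimately have "card (B - {pivot}) \<le> n"
      using ker_bound[of "g ` (B - {pivot})"] B by (simp add: card_image)
    then show ?thesis
      using B pivot by simp
  qed
qed

lemma has_rank_SucI_kernel:
  assumes M: "subspace M" and \<phi>: "module_hom scale (*) \<phi>" and a: "a \<in> M" "\<phi> a \<noteq> 0"
    and ker: "has_rank {x \<in> M. \<phi> x = 0} n"
  shows "has_rank M (Suc n)"
  unfolding has_rank_def
proof (intro conjI allI impI)
  obtain B where B: "B \<subseteq> {x \<in> M. \<phi> x = 0}" "finite B" "independent B" "card B = n"
    using ker unfolding has_rank_def by blast
  then have "independent (insert a B)" "a \<notin> B"
    using a independent_insert_kernel[OF \<phi>, of B a] by blast+
  then show "\<exists>B\<subseteq>M. finite B \<and> independent B \<and> card B = Suc n"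
    using a B by (intro exI[of _ "insert a B"]) auto
qed (use card_independent_le_Suc_rank_kernel[OF M \<phi> ker] in blast)

lemma has_rank_kernelE:
  assumes "subspace M" "module_hom scale (*) \<phi>" "a \<in> M" "\<phi> a \<noteq> 0" and M: "has_rank M m"
  obtains n where "m = Suc n" "has_rank {x \<in> M. \<phi> x = 0} n"
proof -
  obtain n where n: "has_rank {x \<in> M. \<phi> x = 0} n"
    using has_rank_subset[OF M, of "{x \<in> M. \<phi> x = 0}"] by auto
  then have "has_rank M (Suc n)"
    by (rule has_rank_SucI_kernel[OF assms(1-4)])
  then have "m = Suc n"
    by (rule has_rank_unique[OF M])
  then show thesis
    using n by (rule that)
qed

end

section \<open>Connectedness and the Euler formula\<close>

lemma finite_imp_ex_max_image:
  fixes f :: "'a \<Rightarrow> 'b::linorder"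
  assumes "finite A" "A \<noteq> {}"
  shows "\<exists>x\<in>A. \<forall>y\<in>A. f y \<le> f x"
proof -
  obtain x where x: "x \<in> A" "Max (f ` A) = f x"
    using obtains_MAX[OF assms] .
  then have "f y \<le> f x" if "y \<in> A" for y
    using that \<open>finite A\<close> by (simp flip: x(2))
  then show ?thesis
    using x(1) by blast
qed

lemma (in fin_digraph) connectedI_ascending:
  fixes rk :: "'a \<Rightarrow> 'c::linorder"
  assumes "r \<in> verts G"
    and ascend: "\<And>v. v \<in> verts G \<Longrightarrow> v \<noteq> r \<Longrightarrow>
      \<exists>w. (v, w) \<in> parcs (mk_symmetric G) \<and> rk v < rk w"
  shows "connected G"
proof (rule connectedI)
  interpret sym: pair_wf_digraph "mk_symmetric G"
    by (rule wellformed_mk_symmetric)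
  have reach: "v \<rightarrow>\<^sup>*\<^bsub>mk_symmetric G\<^esub> r" if "v \<in> verts G" for v
  proof (rule ccontr)
    define N where "N = {v \<in> verts G. \<not> v \<rightarrow>\<^sup>*\<^bsub>mk_symmetric G\<^esub> r}"
    assume "\<not> v \<rightarrow>\<^sup>*\<^bsub>mk_symmetric G\<^esub> r"
    then have "finite N" "N \<noteq> {}"
      using that by (auto simp: N_def)
    then obtain x where x: "x \<in> N" "\<And>w. w \<in> N \<Longrightarrow> rk w \<le> rk x"
      using finite_imp_ex_max_image[of N rk] by blast
    moreover from this have "x \<noteq> r" "x \<in> verts G"
      using \<open>r \<in> verts G\<close> by (auto simp: N_def)
    ultimately obtain w where w: "(x, w) \<in> parcs (mk_symmetric G)" "rk x < rk w"
      using ascend by blast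
    then have "w \<in> verts G" "w \<notin> N"
      using x(2)[of w] by (auto simp: parcs_mk_symmetric)
    then have "w \<rightarrow>\<^sup>*\<^bsub>mk_symmetric G\<^esub> r"
      by (simp add: N_def)
    then have "x \<rightarrow>\<^sup>*\<^bsub>mk_symmetric G\<^esub> r"
      using w(1) sym.adj_reachable_trans by auto
    then show False
      using x(1) by (simp add: N_def)
  qed
  fix u v assume "u \<in> verts G" "v \<in> verts G"
  have "r \<rightarrow>\<^sup>*\<^bsub>mk_symmetric G\<^esub> v"
    using symmetric_mk_symmetric reach[OF \<open>v \<in> verts G\<close>] by (rule symmetric_reachable)
  with reach[OF \<open>u \<in> verts G\<close>] show "u \<rightarrow>\<^sup>*\<^bsub>mk_symmetric G\<^esub> v"
    by (rule sym.reachable_trans)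
qed (use assms in auto)

interpretation frag: idom_module "frag_cmul :: int \<Rightarrow> ('a \<Rightarrow>\<^sub>0 int) \<Rightarrow> _"
  by (intro idom_module.intro module_frag_cmul)

lemma Z_rank_eqI:
  assumes "frag.has_rank A n"
  shows "Z_rank A = n"
proof -
  obtain B where "B \<subseteq> A" "finite B" "frag.independent B" "card B = n"
    using assms unfolding frag.has_rank_def by blast
  then have "n \<in> {card B |B. finite B \<and> B \<subseteq> A \<and> frag.independent B}"
    by blast
  moreover have "m \<le> n" if "m \<in> {card B |B. finite B \<and> B \<subseteq> A \<and> frag.independent B}" for m
    using that assms unfolding frag.has_rank_def by blast
  ultimately show ?thesis
    unfolding Z_rank_def by (rule cSup_eq_maximum)
qed

lemma subspace_keys_subset: "frag.subspace {c. Poly_Mapping.keys c \<subseteq> S}"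
  by (intro frag.subspaceI) (auto dest: subsetD[OF Poly_Mapping.keys_add])

lemma module_hom_lookup: "module_hom frag_cmul (*) (\<lambda>c. poly_mapping.lookup c x)"
  by (simp add: module_hom_iff module_frag_cmul module_def lookup_add algebra_simps)

lemma has_rank_keys_subset:
  assumes "finite S"
  shows "frag.has_rank {c. Poly_Mapping.keys c \<subseteq> S} (card S)"
  using assms
proof (induction S)
  case empty
  show ?case
    using frag.has_rank_zero by simp
next
  case (insert s S)
  have kernel: "{c \<in> {c. Poly_Mapping.keys c \<subseteq> insert s S}. poly_mapping.lookup c s = 0}
      = {c. Poly_Mapping.keys c \<subseteq> S}"
    using \<open>s \<notin> S\<close> by (auto simp: in_keys_iff)
  have "frag.has_rank
      {c \<in> {c. Poly_Mapping.keys c \<subseteq> insert s S}. poly_mapping.lookup c s = 0} (card S)"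
    unfolding kernel by (rule insert.IH)
  moreover have "frag_of s \<in> {c. Poly_Mapping.keys c \<subseteq> insert s S}"
    "poly_mapping.lookup (frag_of s) s \<noteq> 0"
    by (simp_all add: keys_frag_of)
  ultimately have "frag.has_rank {c. Poly_Mapping.keys c \<subseteq> insert s S} (Suc (card S))"
    by (intro frag.has_rank_SucI_kernel[OF subspace_keys_subset module_hom_lookup])
  then show ?case
    using insert.hyps by simp
qed

lemma boundary_simps [simp]:
  "boundary G 0 = 0"
  "boundary G (frag_of e) = frag_of (head G e) - frag_of (tail G e)"
  "boundary G (c + d) = boundary G c + boundary G d"
  "boundary G (c - d) = boundary G c - boundary G d"
  "boundary G (frag_cmul k c) = frag_cmul k (boundary G c)"
  by (simp_all add: boundary_def frag_extend_add frag_extend_diff frag_extend_cmul)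

lemma module_hom_lookup_boundary:
  "module_hom frag_cmul (*) (\<lambda>c. poly_mapping.lookup (boundary G c) v)"
  by (simp add: module_hom_iff module_frag_cmul module_def lookup_add algebra_simps)

lemma (in fin_digraph) boundary_on_verts:
  assumes "Poly_Mapping.keys c \<subseteq> arcs G"
  shows "Poly_Mapping.keys (boundary G c) \<subseteq> verts G"
    and "(\<Sum>v\<in>verts G. poly_mapping.lookup (boundary G c) v) = 0"
proof -
  have "Poly_Mapping.keys (boundary G c) \<subseteq> verts G
      \<and> (\<Sum>v\<in>verts G. poly_mapping.lookup (boundary G c) v) = 0"
    using assms
  proof (induction c rule: frag_induction)
    case (one e)
    then show ?case
      using Poly_Mapping.keys_diff[of "frag_of (head G e)" "frag_of (tail G e)"]
      by (auto simp: keys_frag_of lookup_minus sum_subtractf)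
  next
    case (diff a b)
    then show ?case
      using Poly_Mapping.keys_diff[of "boundary G a" "boundary G b"]
      by (auto simp: lookup_minus sum_subtractf)
  qed simp
  then show "Poly_Mapping.keys (boundary G c) \<subseteq> verts G"
    and "(\<Sum>v\<in>verts G. poly_mapping.lookup (boundary G c) v) = 0"
    by auto
qed

lemma connected_imp_boundary_path:
  assumes "Digraph_Component.connected G" "u \<in> verts G" "v \<in> verts G"
  obtains p where "Poly_Mapping.keys p \<subseteq> arcs G" "boundary G p = frag_of v - frag_of u"
proof -
  have "u \<rightarrow>\<^sup>*\<^bsub>with_proj (mk_symmetric G)\<^esub> v"
    using assms by (auto simp: connected_def)
  then have "(u, v) \<in> (parcs (mk_symmetric G))\<^sup>*"
    using reachable_rtranclI by fastforce
  then have "\<exists>p. Poly_Mapping.keys p \<subseteq> arcs G \<and> boundary G p = frag_of v - frag_of u"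
  proof (induction rule: rtrancl_induct)
    case base
    show ?case
      by (intro exI[of _ 0]) simp
  next
    case (step x y)
    then obtain p where p: "Poly_Mapping.keys p \<subseteq> arcs G" "boundary G p = frag_of x - frag_of u"
      by blast
    obtain e where e: "e \<in> arcs G" "(x, y) = (tail G e, head G e) \<or> (x, y) = (head G e, tail G e)"
      using step.hyps by (auto simp: parcs_mk_symmetric)
    have "Poly_Mapping.keys (p + frag_of e) \<subseteq> arcs G" "Poly_Mapping.keys (p - frag_of e) \<subseteq> arcs G"
      using p e Poly_Mapping.keys_add[of p "frag_of e"] Poly_Mapping.keys_diff[of p "frag_of e"]
      by (auto simp: keys_frag_of)
    moreover have "boundary G (p + frag_of e) = frag_of y - frag_of u
        \<or> boundary G (p - frag_of e) = frag_of y - frag_of u"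
      using p e by auto
    ultimately show ?case
      by blast
  qed
  then show thesis
    using that by blast
qed

definition chains_closed_at :: "('v, 'e) pre_digraph \<Rightarrow> 'v set \<Rightarrow> ('e \<Rightarrow>\<^sub>0 int) set" where
  "chains_closed_at G W =
     {c. Poly_Mapping.keys c \<subseteq> arcs G \<and> (\<forall>v\<in>W. poly_mapping.lookup (boundary G c) v = 0)}"

lemma subspace_chains_closed_at: "frag.subspace (chains_closed_at G W)"
proof -
  have "chains_closed_at G W = {c. Poly_Mapping.keys c \<subseteq> arcs G}
      \<inter> (\<Inter>v\<in>W. {c. poly_mapping.lookup (boundary G c) v = 0})"
    by (auto simp: chains_closed_at_def)
  moreover have "frag.subspace {c. poly_mapping.lookup (boundary G c) v = 0}" for v
    using module_hom_lookup_boundary by (rule module_hom.subspace_kernel)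
  ultimately show ?thesis
    by (simp add: frag.subspace_inter frag.subspace_Int subspace_keys_subset)
qed

text \<open>Boundaries have augmentation 0, so closedness at the last vertex is automatic.\<close>

lemma (in fin_digraph) H1_eq_chains_closed_at:
  assumes "r \<in> verts G"
  shows "H1 G = chains_closed_at G (verts G - {r})"
proof (intro equalityI subsetI)
  fix c assume c: "c \<in> chains_closed_at G (verts G - {r})"
  then have arcs: "Poly_Mapping.keys c \<subseteq> arcs G"
    by (simp add: chains_closed_at_def)
  have "(\<Sum>v\<in>verts G. poly_mapping.lookup (boundary G c) v) = poly_mapping.lookup (boundary G c) r"
    using c assms by (simp add: sum.remove chains_closed_at_def)
  then have "poly_mapping.lookup (boundary G c) v = 0" if "v \<in> verts G" for v
    using boundary_on_verts(2)[OF arcs] c that by (cases "v = r") (auto simp: chains_closed_at_def)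
  then have "boundary G c = 0"
    using boundary_on_verts(1)[OF arcs] by (intro poly_mapping_eqI) (auto simp: in_keys_iff)
  then show "c \<in> H1 G"
    using arcs by (simp add: H1_def)
qed (auto simp: H1_def chains_closed_at_def)

lemma (in fin_digraph) has_rank_chains_closed_at:
  assumes conn: "Digraph_Component.connected G" and r: "r \<in> verts G"
    and W: "W \<subseteq> verts G - {r}"
  shows "\<exists>n. frag.has_rank (chains_closed_at G W) n \<and> n + card W = card (arcs G)"
proof -
  have "finite W"
    using finite_subset[OF W] by simp
  then show ?thesis
    using W
  proof (induction W)
    case empty
    show ?case
      using has_rank_keys_subset[OF finite_arcs] by (simp add: chains_closed_at_def)
  next
    case (insert v W)
    then obtain m where m: "frag.has_rank (chains_closed_at G W) m" "m + card W = card (arcs G)"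
      by blast
    obtain p where p: "Poly_Mapping.keys p \<subseteq> arcs G" "boundary G p = frag_of v - frag_of r"
      using connected_imp_boundary_path[OF conn r, of v] insert.prems by auto
    have p_closed: "p \<in> chains_closed_at G W"
      and p_open_at_v: "poly_mapping.lookup (boundary G p) v \<noteq> 0"
      using p insert by (auto simp: chains_closed_at_def lookup_minus)
    obtain n where "m = Suc n"
        "frag.has_rank {c \<in> chains_closed_at G W. poly_mapping.lookup (boundary G c) v = 0} n"
      using subspace_chains_closed_at module_hom_lookup_boundary p_closed p_open_at_v m(1)
      by (rule frag.has_rank_kernelE)
    moreover have "{c \<in> chains_closed_at G W. poly_mapping.lookup (boundary G c) v = 0}
        = chains_closed_at G (insert v W)"
      by (auto simp: chains_closed_at_def)
    ultimately show ?case
      using m insert.hyps by auto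
  qed
qed

theorem (in fin_digraph) h1_Euler:
  assumes "Digraph_Component.connected G"
  shows "h1 G + card (verts G) = card (arcs G) + 1"
proof -
  obtain r where r: "r \<in> verts G"
    using assms by (auto simp: connected_def strongly_connected_def)
  have "\<exists>n. frag.has_rank (H1 G) n \<and> n + card (verts G - {r}) = card (arcs G)"
    unfolding H1_eq_chains_closed_at[OF r] using assms r order_refl
    by (rule has_rank_chains_closed_at)
  then obtain n where n: "frag.has_rank (H1 G) n \<and> n + card (verts G - {r}) = card (arcs G)" ..
  then have "h1 G = n"
    unfolding h1_def by (intro Z_rank_eqI) simp
  moreover have "card (verts G) = Suc (card (verts G - {r}))"
    using r by (intro card.remove finite_verts)
  ultimately show ?thesis
    using n by simp
qed

corollary (in fin_digraph) log_divergent_iff: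
  assumes "Digraph_Component.connected G"
  shows "log_divergent G \<longleftrightarrow> card (arcs G) + 2 = 2 * card (verts G)"
  using h1_Euler[OF assms] by (auto simp: log_divergent_def)

corollary (in fin_digraph) convergent_graph_iff:
  assumes "Digraph_Component.connected G"
  shows "convergent_graph G \<longleftrightarrow> card (arcs G) + 3 \<le> 2 * card (verts G)"
  using h1_Euler[OF assms] by (auto simp: convergent_graph_def)

section \<open>Sparsity of simple graphs\<close>

definition endpoints :: "('v, 'e) pre_digraph \<Rightarrow> 'e \<Rightarrow> 'v set" where
  "endpoints G e = {tail G e, head G e}"

definition spanned_verts :: "('v, 'e) pre_digraph \<Rightarrow> 'e set \<Rightarrow> 'v set" where
  "spanned_verts G A = (\<Union>e\<in>A. endpoints G e)"

definition simple_edges :: "('v, 'e) pre_digraph \<Rightarrow> 'e set \<Rightarrow> bool" where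
  "simple_edges G A \<longleftrightarrow> inj_on (endpoints G) A \<and> (\<forall>e\<in>A. tail G e \<noteq> head G e)"

text \<open>The edge bound of Laman's theorem on generically rigid graphs in the plane.\<close>

definition laman_bound :: "('v, 'e) pre_digraph \<Rightarrow> 'e set \<Rightarrow> bool" where
  "laman_bound G A \<longleftrightarrow> A = {} \<or> card A + 3 \<le> 2 * card (spanned_verts G A)"

lemma verts_edge_subgraph: "verts (edge_subgraph G A) = spanned_verts G A"
  by (auto simp: edge_subgraph_def spanned_verts_def endpoints_def)

lemma (in wf_digraph) spanned_verts_subset_verts: "A \<subseteq> arcs G \<Longrightarrow> spanned_verts G A \<subseteq> verts G"
  by (auto simp: spanned_verts_def endpoints_def)

lemma finite_spanned_verts: "finite A \<Longrightarrow> finite (spanned_verts G A)"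
  by (simp add: spanned_verts_def endpoints_def)

lemma spanned_verts_mono: "A \<subseteq> B \<Longrightarrow> spanned_verts G A \<subseteq> spanned_verts G B"
  by (auto simp: spanned_verts_def)

lemma simple_edges_subset: "simple_edges G B \<Longrightarrow> A \<subseteq> B \<Longrightarrow> simple_edges G A"
  by (auto simp: simple_edges_def intro: inj_on_subset)

lemma card_star_less_card_spanned_verts:
  assumes "finite A" "A \<noteq> {}" "simple_edges G A" and star: "\<And>e. e \<in> A \<Longrightarrow> v \<in> endpoints G e"
  shows "card A < card (spanned_verts G A)"
proof -
  let ?X = "spanned_verts G A"
  have "v \<in> ?X"
    using \<open>A \<noteq> {}\<close> star by (auto simp: spanned_verts_def)
  define far_end where "far_end e = endpoints G e - {v}" for e
  have "inj_on far_end A"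
  proof (rule inj_onI)
    fix e f assume ef: "e \<in> A" "f \<in> A" "far_end e = far_end f"
    then have "endpoints G e = endpoints G f"
      using star insert_Diff unfolding far_end_def by metis
    then show "e = f"
      using ef \<open>simple_edges G A\<close> by (auto simp: simple_edges_def dest: inj_onD)
  qed
  moreover have "far_end ` A \<subseteq> (\<lambda>w. {w}) ` (?X - {v})"
    using star \<open>simple_edges G A\<close>
    by (fastforce simp: far_end_def endpoints_def spanned_verts_def simple_edges_def)
  ultimately have "card A \<le> card ((\<lambda>w. {w}) ` (?X - {v}))"
    using assms(1) by (intro card_inj_on_le) (auto simp: finite_spanned_verts)
  also have "\<dots> = card (?X - {v})"
    by (intro card_image) simp
  also have "\<dots> < card ?X"
    using \<open>finite A\<close> \<open>v \<in> ?X\<close> by (intro card_Diff1_less finite_spanned_verts)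
  finally show ?thesis .
qed

lemma laman_bound_remove_vertex:
  assumes "finite A" "simple_edges G A"
    and degree: "card {e \<in> A. v \<in> endpoints G e} \<le> 2"
    and rest: "laman_bound G {e \<in> A. v \<notin> endpoints G e}"
  shows "laman_bound G A"
proof -
  define S where "S = {e \<in> A. v \<in> endpoints G e}"
  define R where "R = {e \<in> A. v \<notin> endpoints G e}"
  have A: "A = S \<union> R" "S \<inter> R = {}" "S \<subseteq> A" "R \<subseteq> A"
    by (auto simp: S_def R_def)
  have fin: "finite S" "finite R"
    using A \<open>finite A\<close> finite_subset by auto
  have star: "v \<in> endpoints G e" if "e \<in> S" for e
    using that by (simp add: S_def)
  have "card S \<le> 2"
    using degree by (simp only: S_def)
  then have card_A: "card A \<le> card R + 2"
    using A(1,2) fin by (simp add: card_Un_disjoint)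
  have bound_R: "laman_bound G R"
    using rest by (simp only: R_def)
  consider (no_star) "S = {}" | (only_star) "R = {}" "S \<noteq> {}" | (both) "R \<noteq> {}" "S \<noteq> {}"
    by blast
  then show ?thesis
  proof cases
    case no_star
    then show ?thesis
      using A(1) bound_R by simp
  next
    case only_star
    then have "card S < card (spanned_verts G S)"
      using simple_edges_subset[OF \<open>simple_edges G A\<close> \<open>S \<subseteq> A\<close>] fin star
      by (intro card_star_less_card_spanned_verts)
    moreover have "card S > 0"
      using only_star fin by (simp add: card_gt_0_iff)
    ultimately show ?thesis
      using only_star A(1) by (simp add: laman_bound_def)
  next
    case both
    then have "v \<in> spanned_verts G A" "v \<notin> spanned_verts G R"
      using A(3) star by (auto simp: spanned_verts_def R_def)
    then have "spanned_verts G R \<subset> spanned_verts G A"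
      using spanned_verts_mono[OF \<open>R \<subseteq> A\<close>, of G] by auto
    then have "card (spanned_verts G R) < card (spanned_verts G A)"
      using \<open>finite A\<close> by (intro psubset_card_mono finite_spanned_verts)
    then show ?thesis
      using both bound_R card_A by (simp add: laman_bound_def)
  qed
qed

lemma incident_edges_at_max_rank:
  fixes rk :: "'v \<Rightarrow> 'a::linorder"
  assumes upper: "\<And>e. e \<in> A \<Longrightarrow> upper e \<in> endpoints G e"
    and rk_less_upper: "\<And>e v. e \<in> A \<Longrightarrow> v \<in> endpoints G e \<Longrightarrow> v \<noteq> upper e \<Longrightarrow> rk v < rk (upper e)"
    and v_max: "\<And>w. w \<in> spanned_verts G A \<Longrightarrow> rk w \<le> rk v"
  shows "{e \<in> A. v \<in> endpoints G e} = {e \<in> A. upper e = v}"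
proof -
  have "upper e = v" if "e \<in> A" "v \<in> endpoints G e" for e
  proof (rule ccontr)
    assume "upper e \<noteq> v"
    then have "rk v < rk (upper e)"
      using rk_less_upper that by auto
    moreover have "upper e \<in> spanned_verts G A"
      using upper that by (auto simp: spanned_verts_def)
    ultimately show False
      using v_max by fastforce
  qed
  then show ?thesis
    using upper by blast
qed

lemma laman_bound_degenerate:
  fixes rk :: "'v \<Rightarrow> 'a::linorder"
  assumes "finite A" "simple_edges G A"
    and "\<And>e. e \<in> A \<Longrightarrow> upper e \<in> endpoints G e"
    and "\<And>e v. e \<in> A \<Longrightarrow> v \<in> endpoints G e \<Longrightarrow> v \<noteq> upper e \<Longrightarrow> rk v < rk (upper e)"
    and "\<And>v. card {e \<in> A. upper e = v} \<le> 2"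
  shows "laman_bound G A"
  using assms
proof (induction A rule: finite_psubset_induct)
  case (psubset A)
  show ?case
  proof (cases "A = {}")
    case False
    then have "spanned_verts G A \<noteq> {}"
      by (auto simp: spanned_verts_def endpoints_def)
    then obtain v where v: "v \<in> spanned_verts G A"
      and v_max: "\<And>w. w \<in> spanned_verts G A \<Longrightarrow> rk w \<le> rk v"
      using finite_imp_ex_max_image[OF finite_spanned_verts[OF \<open>finite A\<close>], of G rk] by blast
    have "{e \<in> A. v \<in> endpoints G e} = {e \<in> A. upper e = v}"
      using psubset.prems(2,3) v_max by (rule incident_edges_at_max_rank)
    then have degree: "card {e \<in> A. v \<in> endpoints G e} \<le> 2"
      using psubset.prems(4) by simp
    have rest: "laman_bound G {e \<in> A. v \<notin> endpoints G e}" (is "laman_bound G ?R")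
    proof (rule psubset.IH)
      show "?R \<subset> A"
        using v by (auto simp: spanned_verts_def)
      show "simple_edges G ?R"
        using psubset.prems(1) by (rule simple_edges_subset) auto
      have "card {e \<in> ?R. upper e = w} \<le> card {e \<in> A. upper e = w}" for w
        using \<open>finite A\<close> by (intro card_mono) auto
      then show "card {e \<in> ?R. upper e = w} \<le> 2" for w
        using psubset.prems(4) order_trans by blast
    qed (use psubset.prems in auto)
    show ?thesis
      using psubset.hyps psubset.prems(1) degree rest by (rule laman_bound_remove_vertex)
  qed (simp add: laman_bound_def)
qed

lemma (in fin_digraph) fin_digraph_edge_subgraph:
  assumes "A \<subseteq> arcs G"
  shows "fin_digraph (edge_subgraph G A)"
  using finite_subset[OF assms finite_arcs] by unfold_locales (auto simp: edge_subgraph_def)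

lemma (in fin_digraph) convergent_edge_subgraph:
  assumes "A \<subseteq> arcs G" "A \<noteq> {}" "Digraph_Component.connected (edge_subgraph G A)"
    and "laman_bound G A"
  shows "convergent_graph (edge_subgraph G A)"
proof -
  interpret H: fin_digraph "edge_subgraph G A"
    using assms(1) by (rule fin_digraph_edge_subgraph)
  have "arcs (edge_subgraph G A) = A"
    by (simp add: edge_subgraph_def)
  then show ?thesis
    using assms by (simp add: H.convergent_graph_iff verts_edge_subgraph laman_bound_def)
qed

section \<open>Generalized zigzag graphs\<close>

text \<open>
  The lexicographic order of these ranks lists the vertices as
  \<open>u\<^sub>1, u\<^sub>2, v\<^sub>1\<^sub>1, v\<^sub>1\<^sub>2, \<dots>, u\<^sub>3, v\<^sub>2\<^sub>1, \<dots>, u\<^sub>t\<^sub>+\<^sub>2\<close>.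
\<close>

fun gzz_rank :: "gzz_vertex \<Rightarrow> nat \<times> nat" where
  "gzz_rank (U k) = (k, 0)"
| "gzz_rank (V i j) = (i + 1, j)"

locale generalized_zigzag =
  fixes t :: nat and l :: "nat \<Rightarrow> nat"
  assumes t_ge_1: "t \<ge> 1"
    and path_length_ge_1: "\<And>i. 1 \<le> i \<Longrightarrow> i \<le> t \<Longrightarrow> l i \<ge> 1"
    and first_path_length_ge_2: "l 1 \<ge> 2"
begin

abbreviation \<Gamma> :: "(gzz_vertex, gzz_edge) pre_digraph" where
  "\<Gamma> \<equiv> GZZ t l"

sublocale fin_digraph \<Gamma>
  by (rule fin_digraph_GZZ)

fun upper_end :: "gzz_edge \<Rightarrow> gzz_vertex" where
  "upper_end (Spoke i j) = V i j"
| "upper_end e = head \<Gamma> e"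

lemma upper_end_endpoint: "upper_end e \<in> endpoints \<Gamma> e"
  by (cases e) (auto simp: GZZ_def endpoints_def)

lemma upper_end_in_verts: "e \<in> arcs \<Gamma> \<Longrightarrow> upper_end e \<in> verts \<Gamma>"
  using upper_end_endpoint[of e] by (auto simp: endpoints_def)

lemma gzz_rank_less_upper_end:
  assumes "e \<in> arcs \<Gamma>" "v \<in> endpoints \<Gamma> e" "v \<noteq> upper_end e"
  shows "gzz_rank v < gzz_rank (upper_end e)"
  using assms by (auto simp: GZZ_def endpoints_def side_vertex_def)

lemma ex_ascending_arc:
  assumes "v \<in> verts \<Gamma>" "v \<noteq> U (t + 2)"
  shows "\<exists>e\<in>arcs \<Gamma> - {Closing}. v \<in> endpoints \<Gamma> e \<and> gzz_rank v < gzz_rank (upper_end e)"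
proof (cases v)
  case (U k)
  then show ?thesis
    using assms by (intro bexI[of _ "Spine k"]) (auto simp: GZZ_def endpoints_def)
next
  case (V i j)
  then show ?thesis
    using assms
    by (intro bexI[of _ "Side i j"]) (auto simp: GZZ_def endpoints_def side_vertex_def)
qed

lemma connected_GZZ: "Digraph_Component.connected \<Gamma>"
proof (rule connectedI_ascending)
  show "U (t + 2) \<in> verts \<Gamma>"
    by (simp add: GZZ_def)
  fix v assume "v \<in> verts \<Gamma>" "v \<noteq> U (t + 2)"
  from ex_ascending_arc[OF this]
  obtain e where e: "e \<in> arcs \<Gamma>" "v \<in> endpoints \<Gamma> e" "gzz_rank v < gzz_rank (upper_end e)"
    by blast
  then have "(v, upper_end e) \<in> parcs (mk_symmetric \<Gamma>)"
    using upper_end_endpoint[of e] by (auto simp: endpoints_def parcs_mk_symmetric)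
  with e(3) show "\<exists>w. (v, w) \<in> parcs (mk_symmetric \<Gamma>) \<and> gzz_rank v < gzz_rank w"
    by blast
qed

lemma simple_edges_arcs: "simple_edges \<Gamma> (arcs \<Gamma>)"
  unfolding simple_edges_def
proof (intro conjI inj_onI ballI)
  fix e f
  assume "e \<in> arcs \<Gamma>" "f \<in> arcs \<Gamma>" "endpoints \<Gamma> e = endpoints \<Gamma> f"
  then show "e = f"
    using t_ge_1 first_path_length_ge_2
    by (cases e; cases f)
      (auto simp: GZZ_def endpoints_def side_vertex_def doubleton_eq_iff split: if_splits)
qed (auto simp: GZZ_def side_vertex_def split: if_splits)

definition back_arcs :: "gzz_vertex \<Rightarrow> gzz_edge set" where
  "back_arcs v = {e \<in> arcs \<Gamma> - {Closing}. upper_end e = v}"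

lemma back_arcs_U1: "back_arcs (U 1) = {}"
  by (auto simp: back_arcs_def GZZ_def side_vertex_def split: if_splits)

lemma back_arcs_U2: "back_arcs (U 2) = {Spine 1}"
  by (auto simp: back_arcs_def GZZ_def side_vertex_def split: if_splits)

lemma card_back_arcs:
  assumes "v \<in> verts \<Gamma> - {U 1, U 2}"
  shows "card (back_arcs v) = 2"
proof (cases v)
  case (U k)
  define i where "i = k - 2"
  have "v = U (i + 2)" "1 \<le> i" "i \<le> t"
    using U assms by (auto simp: GZZ_def i_def)
  then have "back_arcs v = {Spine (i + 1), Side i (l i - 1)}"
    using path_length_ge_1[of i]
    by (auto simp: back_arcs_def GZZ_def side_vertex_def split: if_splits)
  then show ?thesis
    by simp
next
  case (V i j)
  then have "back_arcs v = {Side i (j - 1), Spoke i j}"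
    using assms by (auto simp: back_arcs_def GZZ_def side_vertex_def split: if_splits)
  then show ?thesis
    by simp
qed

lemma card_back_arcs_le: "card (back_arcs v) \<le> 2"
proof -
  consider (not_vertex) "v \<notin> verts \<Gamma>" | "v = U 1" | "v = U 2"
    | "v \<in> verts \<Gamma> - {U 1, U 2}"
    by blast
  then show ?thesis
  proof cases
    case not_vertex
    then have "back_arcs v = {}"
      using upper_end_in_verts by (auto simp: back_arcs_def)
    then show ?thesis
      by simp
  qed (use back_arcs_U1 back_arcs_U2 card_back_arcs in auto)
qed

lemma card_arcs_with_upper_end_in:
  assumes "{U 1, U 2} \<subseteq> X" "X \<subseteq> verts \<Gamma>"
  shows "card {e \<in> arcs \<Gamma> - {Closing}. upper_end e \<in> X} + 3 = 2 * card X"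
proof -
  define Y where "Y = X - {U 1, U 2}"
  have "finite X"
    using finite_subset[OF assms(2)] by simp
  then have Y: "X = insert (U 1) (insert (U 2) Y)" "finite Y" "U 1 \<notin> Y" "U 2 \<notin> Y"
    using assms(1) by (auto simp: Y_def)
  have "{e \<in> arcs \<Gamma> - {Closing}. upper_end e \<in> X} = (\<Union>v\<in>X. back_arcs v)"
    by (auto simp: back_arcs_def)
  also have "card \<dots> = (\<Sum>v\<in>X. card (back_arcs v))"
    using \<open>finite X\<close> by (intro card_UN_disjoint) (auto simp: back_arcs_def)
  also have "\<dots> = 1 + (\<Sum>v\<in>Y. card (back_arcs v))"
    unfolding Y(1) using Y(2-4) by (simp add: back_arcs_U1 back_arcs_U2 del: One_nat_def)
  also have "(\<Sum>v\<in>Y. card (back_arcs v)) = (\<Sum>v\<in>Y. 2)"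
    using assms(2) by (intro sum.cong refl card_back_arcs) (auto simp: Y_def)
  finally show ?thesis
    using Y by simp
qed

lemma card_arcs: "card (arcs \<Gamma>) + 2 = 2 * card (verts \<Gamma>)"
proof -
  have "card {e \<in> arcs \<Gamma> - {Closing}. upper_end e \<in> verts \<Gamma>} + 3 = 2 * card (verts \<Gamma>)"
    by (rule card_arcs_with_upper_end_in) (auto simp: GZZ_def)
  moreover have "{e \<in> arcs \<Gamma> - {Closing}. upper_end e \<in> verts \<Gamma>} = arcs \<Gamma> - {Closing}"
    using upper_end_in_verts by auto
  moreover have "card (arcs \<Gamma>) = Suc (card (arcs \<Gamma> - {Closing}))"
    by (intro card.remove finite_arcs) (simp add: GZZ_def)
  ultimately show ?thesis
    by simp
qed

lemma laman_bound_without_Closing: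
  assumes "A \<subseteq> arcs \<Gamma> - {Closing}"
  shows "laman_bound \<Gamma> A"
proof (rule laman_bound_degenerate[where upper = upper_end and rk = gzz_rank])
  show "finite A"
    using assms by (rule finite_subset) simp
  show "simple_edges \<Gamma> A"
    using simple_edges_arcs by (rule simple_edges_subset) (use assms in auto)
  show "card {e \<in> A. upper_end e = v} \<le> 2" for v
  proof -
    have "card {e \<in> A. upper_end e = v} \<le> card (back_arcs v)"
      using assms by (intro card_mono) (auto simp: back_arcs_def)
    also have "\<dots> \<le> 2"
      by (rule card_back_arcs_le)
    finally show ?thesis .
  qed
qed (use assms gzz_rank_less_upper_end upper_end_endpoint in auto)

text \<open>Without \<open>u\<^sub>2\<close> at most one edge besides the closing one is left at \<open>u\<^sub>1\<close>.\<close>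

lemma laman_bound_avoiding_U2:
  assumes "A \<subseteq> arcs \<Gamma>" "U 2 \<notin> spanned_verts \<Gamma> A"
  shows "laman_bound \<Gamma> A"
proof (rule laman_bound_remove_vertex)
  show "finite A"
    using assms(1) finite_arcs by (rule finite_subset)
  show "simple_edges \<Gamma> A"
    using simple_edges_arcs assms(1) by (rule simple_edges_subset)
  have "e \<in> {Side 1 0, Closing}" if "e \<in> A" "U 1 \<in> endpoints \<Gamma> e" for e
  proof -
    have "U 2 \<notin> endpoints \<Gamma> e" "e \<in> arcs \<Gamma>"
      using assms that by (auto simp: spanned_verts_def)
    then show ?thesis
      using that(2) by (auto simp: GZZ_def endpoints_def side_vertex_def split: if_splits)
  qed
  then have "card {e \<in> A. U 1 \<in> endpoints \<Gamma> e} \<le> card {Side 1 0, Closing}"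
    by (intro card_mono) auto
  then show "card {e \<in> A. U 1 \<in> endpoints \<Gamma> e} \<le> 2"
    by simp
  show "laman_bound \<Gamma> {e \<in> A. U 1 \<notin> endpoints \<Gamma> e}"
    using assms(1) by (intro laman_bound_without_Closing) (auto simp: GZZ_def endpoints_def)
qed

lemma ex_missing_arc_with_upper_end_in_spanned:
  assumes "A \<subset> arcs \<Gamma>" "Closing \<in> A"
  shows "\<exists>e\<in>arcs \<Gamma> - A. upper_end e \<in> spanned_verts \<Gamma> A"
proof (rule ccontr)
  let ?X = "spanned_verts \<Gamma> A"
  assume "\<not> ?thesis"
  then have closed: "e \<in> A" if "e \<in> arcs \<Gamma>" "upper_end e \<in> ?X" for e
    using that by blast
  have "verts \<Gamma> - ?X = {}"
  proof (rule ccontr)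
    assume "verts \<Gamma> - ?X \<noteq> {}"
    then obtain v where v: "v \<in> verts \<Gamma> - ?X"
      and v_max: "\<And>w. w \<in> verts \<Gamma> - ?X \<Longrightarrow> gzz_rank w \<le> gzz_rank v"
      using finite_imp_ex_max_image[OF finite_Diff[OF finite_verts], of ?X gzz_rank] by blast
    have "U (t + 2) \<in> ?X"
      using \<open>Closing \<in> A\<close> by (force simp: spanned_verts_def endpoints_def GZZ_def)
    then have "v \<in> verts \<Gamma>" "v \<noteq> U (t + 2)"
      using v by auto
    from ex_ascending_arc[OF this]
    obtain e where e: "e \<in> arcs \<Gamma>" "v \<in> endpoints \<Gamma> e" "gzz_rank v < gzz_rank (upper_end e)"
      by blast
    then have "upper_end e \<in> ?X"
      using v_max upper_end_in_verts by fastforce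
    then have "e \<in> A"
      using closed e(1) by blast
    then show False
      using e(2) v by (auto simp: spanned_verts_def)
  qed
  then have "arcs \<Gamma> \<subseteq> A"
    using closed upper_end_in_verts by blast
  then show False
    using assms(1) by blast
qed

lemma laman_bound_spanning_U2:
  assumes A: "A \<subset> arcs \<Gamma>" "Closing \<in> A" "U 2 \<in> spanned_verts \<Gamma> A"
  shows "laman_bound \<Gamma> A"
proof -
  let ?X = "spanned_verts \<Gamma> A"
  let ?E = "{e \<in> arcs \<Gamma> - {Closing}. upper_end e \<in> ?X}"
  have "A - {Closing} \<subseteq> ?E"
    using A(1) upper_end_endpoint by (auto simp: spanned_verts_def)
  moreover from ex_missing_arc_with_upper_end_in_spanned[OF A(1,2)]
  obtain e where "e \<in> ?E" "e \<notin> A"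
    using A(2) by blast
  ultimately have "A - {Closing} \<subset> ?E"
    by blast
  then have "card (A - {Closing}) < card ?E"
    by (rule psubset_card_mono[rotated]) simp
  moreover have "card A = Suc (card (A - {Closing}))"
    using A(1,2) finite_subset[of A "arcs \<Gamma>"] by (intro card.remove) auto
  moreover have "card ?E + 3 = 2 * card ?X"
  proof (rule card_arcs_with_upper_end_in)
    show "{U 1, U 2} \<subseteq> ?X"
      using A(2,3) by (force simp: spanned_verts_def endpoints_def GZZ_def)
    show "?X \<subseteq> verts \<Gamma>"
      using A(1) by (intro spanned_verts_subset_verts) auto
  qed
  ultimately show ?thesis
    by (simp add: laman_bound_def)
qed

theorem laman_bound_proper_subset:
  assumes "A \<subset> arcs \<Gamma>"
  shows "laman_bound \<Gamma> A"
proof -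
  consider (without_Closing) "Closing \<notin> A" | (avoiding_U2) "U 2 \<notin> spanned_verts \<Gamma> A"
    | (spanning_U2) "Closing \<in> A" "U 2 \<in> spanned_verts \<Gamma> A"
    by blast
  then show ?thesis
  proof cases
    case without_Closing
    then show ?thesis
      using assms by (intro laman_bound_without_Closing) auto
  next
    case avoiding_U2
    then show ?thesis
      using assms by (intro laman_bound_avoiding_U2) auto
  next
    case spanning_U2
    then show ?thesis
      using assms by (intro laman_bound_spanning_U2)
  qed
qed

end

theorem theorem2p2p5:
  fixes t :: nat and l :: "nat \<Rightarrow> nat"
  assumes "t \<ge> 1"
    and "\<And>i. 1 \<le> i \<Longrightarrow> i \<le> t \<Longrightarrow> l i \<ge> 1"
    and "l 1 \<ge> 2"
    and "l t \<ge> 2"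
  shows "primitively_log_divergent (GZZ t l)"
proof -
  interpret generalized_zigzag t l
    by unfold_locales (fact assms)+
  show ?thesis
    unfolding primitively_log_divergent_def
  proof (intro conjI allI impI)
    show "log_divergent \<Gamma>"
      using connected_GZZ card_arcs by (simp add: log_divergent_iff)
    fix A
    assume "A \<noteq> {} \<and> A \<subset> arcs \<Gamma> \<and> Digraph_Component.connected (edge_subgraph \<Gamma> A)"
    then show "convergent_graph (edge_subgraph \<Gamma> A)"
      by (intro convergent_edge_subgraph laman_bound_proper_subset) auto
  qed
qed

end
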